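(* Let $K\ge1$ be a finite integer, and let $L>0$, $L_o>0$ and $L_c\ge 1$ be real numbers. Define, for $\bar q\in(0,\infty)$, $$\Omega(\bar q)=\frac{P_1(\bar q)\,L}{P_1(\bar q)(L+L_o)+P_0(\bar q)+P_c(\bar q)\,L_c},$$ where $P_1(\bar q)=\bar q e^{-\bar q}$, $P_0(\bar q)=e^{-\bar q}$ and $P_c(\bar q)=1-P_1(\bar q)-P_0(\bar q)$. The equation $$\frac1{L_c}-1=(\bar q-1)e^{\bar q}$$ has a unique solution $\bar q=\bar q^*\in(0,\infty)$, and $\bar q^*\le 1$. For every $q_0\in[\bar q^*,1]$, the equation $$\frac{\bar q^*}{q_0}=\frac{\sum_{k=0}^K\left(1-e^{-\bar q^*}\right)^k}{\sum_{k=0}^K\left(1-e^{-\bar q^*}\right)^k m^k}$$ has a solution $m=m^*\in(0,\infty)$, and for the choice $q_k=q_0/(m^* )^k$, $k\in\{0,\dots,K\}$, the following hold: (i) the ordinary differential equation $$\frac{\mathrm d\phi_k}{\mathrm dt}(t)=q_{k-1}\phi_{k-1}(t)\gamma(t)-q_k\phi_k(t),\qquad k\in\{1,\dots,K\},$$ with $\phi_0(t)=1-\sum_{k=1}^K\phi_k(t)$, $\bar q(t)=\sum_{k=0}^Kq_k\phi_k(t)$ and $\gamma(t)=1-e^{-\bar q(t)}$, is globally stable; (ii) the aggregate throughput is maximized, i.e. the limit $\bar q:=\lim_{t\to\infty}\bar q(t)$ satisfies $\Omega(\bar q)=\max_{x\in(0,\infty)}\Omega(x)$.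
   Context: $L$, $L_c$ and $L_o$ are the average duration of a successful packet transmission, the duration of a collision, and the overhead of a successful transmission, respectively, expressed in units of time-slots. $\Omega(\bar q)$ is the aggregate throughput when the average scaled attempt rate converges to $\bar q$. The state $(\phi_0(t),\dots,\phi_K(t))$ of the ODE is a probability vector on $\{0,\dots,K\}$. The ODE is called globally stable if it has a unique equilibrium point in the set of probability vectors and, for every initial probability vector, the solution converges to this equilibrium point as $t\to\infty$. When this holds, $\lim_{t\to\infty}\bar q(t)$ exists and does not depend on the initial condition. *)

theory Defs
  imports "HOL-Analysis.Analysis" "HOL-Homology.Simplices"
begin

text \<open>
  States are functions \<^typ>\<open>nat \<Rightarrow> real\<close>; the probability vectors on \<open>{0..K}\<close> are the points of
  \<^const>\<open>standard_simplex\<close> \<open>K\<close>, whose coordinates with index above \<open>K\<close> are \<open>0\<close>.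
\<close>

definition attempt_rate :: "nat \<Rightarrow> (nat \<Rightarrow> real) \<Rightarrow> (nat \<Rightarrow> real) \<Rightarrow> real" where
  "attempt_rate K q x = (\<Sum>k\<le>K. q k * x k)"

definition collision_prob :: "nat \<Rightarrow> (nat \<Rightarrow> real) \<Rightarrow> (nat \<Rightarrow> real) \<Rightarrow> real" where
  "collision_prob K q x = 1 - exp (- attempt_rate K q x)"

text \<open>Only used for \<open>k \<in> {1..K}\<close>; the coordinate \<open>0\<close> is determined by the others.\<close>

definition drift :: "nat \<Rightarrow> (nat \<Rightarrow> real) \<Rightarrow> (nat \<Rightarrow> real) \<Rightarrow> nat \<Rightarrow> real" where
  "drift K q x k = q (k - 1) * x (k - 1) * collision_prob K q x - q k * x k"

text \<open>Solutions on \<open>[0, \<infinity>)\<close>, with the one-sided derivative at time \<open>0\<close>.\<close>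

definition ode_solution :: "nat \<Rightarrow> (nat \<Rightarrow> real) \<Rightarrow> (real \<Rightarrow> nat \<Rightarrow> real) \<Rightarrow> bool" where
  "ode_solution K q \<phi> \<longleftrightarrow>
     (\<forall>t\<ge>0. \<phi> t 0 = 1 - (\<Sum>k=1..K. \<phi> t k) \<and>
            (\<forall>k>K. \<phi> t k = 0) \<and>
            (\<forall>k\<in>{1..K}. ((\<lambda>s. \<phi> s k) has_real_derivative drift K q (\<phi> t) k) (at t within {0..})))"

definition equilibrium :: "nat \<Rightarrow> (nat \<Rightarrow> real) \<Rightarrow> (nat \<Rightarrow> real) \<Rightarrow> bool" where
  "equilibrium K q x \<longleftrightarrow> x \<in> standard_simplex K \<and> (\<forall>k\<in>{1..K}. drift K q x k = 0)"

text \<open>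
  A solution is not required to stay among the probability vectors, so global stability asserts
  this along with the existence of solutions.
\<close>

definition globally_stable :: "nat \<Rightarrow> (nat \<Rightarrow> real) \<Rightarrow> bool" where
  "globally_stable K q \<longleftrightarrow>
     (\<exists>!x. equilibrium K q x) \<and>
     (\<forall>x. equilibrium K q x \<longrightarrow>
       (\<forall>y\<in>standard_simplex K.
          (\<exists>\<phi>. ode_solution K q \<phi> \<and> \<phi> 0 = y) \<and>
          (\<forall>\<phi>. ode_solution K q \<phi> \<and> \<phi> 0 = y \<longrightarrow>
             (\<forall>t\<ge>0. \<phi> t \<in> standard_simplex K) \<and>
             (\<forall>k\<le>K. ((\<lambda>t. \<phi> t k) \<longlongrightarrow> x k) at_top))))"

definition P0 :: "real \<Rightarrow> real" where
  "P0 q = exp (- q)"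

definition P1 :: "real \<Rightarrow> real" where
  "P1 q = q * exp (- q)"

definition Pc :: "real \<Rightarrow> real" where
  "Pc q = 1 - P1 q - P0 q"

definition throughput :: "real \<Rightarrow> real \<Rightarrow> real \<Rightarrow> real \<Rightarrow> real" where
  "throughput L Lo Lc q = P1 q * L / (P1 q * (L + Lo) + P0 q + Pc q * Lc)"

end

theory Submission
  imports Defs
begin

text \<open>
  Extended by the equation for \<open>\<phi> 0\<close>, the vector field conserves the total mass. On vectors of mass
  at most 1 the attempt rate \<open>u\<close> is at most \<open>q0 \<le> 1\<close>, where \<open>u * exp (- u)\<close> increases; hence
  \<open>x + F x\<close> is monotone in \<open>x\<close>, and the semiflow is order preserving. Comparing two solutions with
  the one that starts from the meet of their initial values shows that the semiflow is
  nonexpansive in the l1 norm. A mass difference travels around the cycle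
  \<open>0 \<rightarrow> 1 \<rightarrow> \<dots> \<rightarrow> K \<rightarrow> 0\<close>, so after time \<open>K\<close> both solutions exceed the lower one in every coordinate by
  a fixed fraction of their initial excess: the time-\<open>K\<close> map is a strict l1 contraction on the
  probability vectors. Since \<open>q\<^sup>* \<le> q0\<close> forces \<open>m \<ge> 1\<close>, all \<open>q0 / m ^ k\<close> lie in \<open>(0, 1]\<close>.
\<close>

section \<open>The extended vector field: its increasing part and conservation of mass\<close>

text \<open>Since \<open>v\<close> is at most 1, \<open>v * (v - u)\<close> is at most
  \<open>v - u\<close>. Replacing the factor \<open>1 - (v - u)\<close> by the larger
  \<open>exp (- (v - u))\<close> and multiplying by \<open>exp (- u)\<close> then gives the
  claim.\<close>

lemma mult_exp_neg_mono:
  fixes u v :: real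
  assumes "u \<le> v" "0 \<le> v" "v \<le> 1"
  shows "u * exp (- u) \<le> v * exp (- v)"
proof -
  have "u \<le> v * (1 - (v - u))"
    using mult_right_mono[of v 1 "v - u"] assms by (simp add: algebra_simps)
  also have "\<dots> \<le> v * exp (- (v - u))"
    using exp_ge_add_one_self[of "- (v - u)"] assms
    by (intro mult_left_mono) (simp_all only: diff_conv_add_uminus)
  finally have "u * exp (- u) \<le> v * exp (- (v - u)) * exp (- u)"
    by (intro mult_right_mono) auto
  also have "\<dots> = v * exp (- v)"
    by (simp add: exp_minus exp_diff field_simps)
  finally show ?thesis .
qed

text \<open>Mass below 1 is allowed because the meet of two probability vectors loses mass and the
  iteration below starts at 0. Coordinates above \<open>K\<close> are left free.\<close>

definition sub_simplex :: "nat \<Rightarrow> (nat \<Rightarrow> real) set" where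
  "sub_simplex K = {x. (\<forall>k\<le>K. 0 \<le> x k) \<and> (\<Sum>k\<le>K. x k) \<le> 1}"

text \<open>
  Coordinate 0 is minus the sum of the drifts, regrouped so that everything but \<open>- q 0 * x 0\<close> is
  increasing in the state as long as the attempt rate is at most 1.
\<close>

definition flow :: "nat \<Rightarrow> (nat \<Rightarrow> real) \<Rightarrow> (nat \<Rightarrow> real) \<Rightarrow> nat \<Rightarrow> real" where
  "flow K q x k =
     (if k = 0 then attempt_rate K q x * exp (- attempt_rate K q x)
        + collision_prob K q x * (q K * x K) - q 0 * x 0
      else drift K q x k)"

text \<open>The cyclic predecessor: collided attempts at stage \<open>K\<close> re-enter at stage
  0.\<close>

definition pred_mod :: "nat \<Rightarrow> nat \<Rightarrow> nat" where
  "pred_mod K k = (if k = 0 then K else k - 1)"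

lemma sub_simplexD:
  assumes "x \<in> sub_simplex K"
  shows "k \<le> K \<Longrightarrow> 0 \<le> x k" "(\<Sum>k\<le>K. x k) \<le> 1"
  using assms by (auto simp: sub_simplex_def)

lemma standard_simplex_sub: "standard_simplex K \<subseteq> sub_simplex K"
  by (auto simp: standard_simplex_def sub_simplex_def)

text \<open>Identifies coordinate 0 of \<open>flow\<close> as the derivative that constant total
  mass forces on \<open>x 0\<close>. The gains of the stages \<open>1..K\<close> are the losses of
  the stages \<open>0..K-1\<close> times the collision probability, so both sums reduce to the
  attempt rate minus one end term.\<close>

lemma sum_drift:
  "(\<Sum>k=1..K. drift K q x k) = - flow K q x 0"
proof -
  have "(\<Sum>k=1..K. q (k - 1) * x (k - 1)) = (\<Sum>k<K. q k * x k)"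
    by (rule sum.reindex_bij_witness[of _ Suc "\<lambda>k. k - 1"]) auto
  moreover have "(\<Sum>k\<le>K. q k * x k) = (\<Sum>k<K. q k * x k) + q K * x K"
    by (simp add: lessThan_Suc_atMost[symmetric])
  ultimately have A: "(\<Sum>k=1..K. q (k - 1) * x (k - 1)) = attempt_rate K q x - q K * x K"
    by (simp add: attempt_rate_def)
  have B: "(\<Sum>k=1..K. q k * x k) = attempt_rate K q x - q 0 * x 0"
    by (simp add: attempt_rate_def atMost_atLeast0 sum.atLeast_Suc_atMost)
  have "(\<Sum>k=1..K. drift K q x k) =
      (\<Sum>k=1..K. q (k - 1) * x (k - 1)) * collision_prob K q x - (\<Sum>k=1..K. q k * x k)"
    by (simp only: drift_def sum_subtractf sum_distrib_right)
  also have "\<dots> = - flow K q x 0"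
    unfolding A B by (simp add: flow_def collision_prob_def algebra_simps)
  finally show ?thesis .
qed

lemma sum_flow: "(\<Sum>k\<le>K. flow K q x k) = 0"
proof -
  have "(\<Sum>k\<le>K. flow K q x k) = flow K q x 0 + (\<Sum>k=1..K. flow K q x k)"
    by (simp add: atMost_atLeast0 sum.atLeast_Suc_atMost)
  also have "(\<Sum>k=1..K. flow K q x k) = (\<Sum>k=1..K. drift K q x k)"
    by (intro sum.cong) (auto simp: flow_def)
  finally show ?thesis by (simp only: sum_drift)
qed

lemma continuous_on_flow:
  assumes "\<And>k. k \<le> K \<Longrightarrow> continuous_on S (\<lambda>t. f t k)" "k \<le> K"
  shows "continuous_on S (\<lambda>t. flow K q (f t) k)"
proof -
  have 1: "continuous_on S (\<lambda>t. attempt_rate K q (f t))"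
    unfolding attempt_rate_def by (intro continuous_intros assms) auto
  have 2: "continuous_on S (\<lambda>t. collision_prob K q (f t))"
    unfolding collision_prob_def by (intro continuous_intros 1)
  show ?thesis
    using assms(2) by (cases "k = 0")
      (auto simp: flow_def drift_def intro!: continuous_intros 1 2 assms(1))
qed

lemma tendsto_flow:
  assumes "\<And>k. k \<le> K \<Longrightarrow> ((\<lambda>t. f t k) \<longlongrightarrow> x k) F" "k \<le> K"
  shows "((\<lambda>t. flow K q (f t) k) \<longlongrightarrow> flow K q x k) F"
proof -
  have 1: "((\<lambda>t. attempt_rate K q (f t)) \<longlongrightarrow> attempt_rate K q x) F"
    unfolding attempt_rate_def by (intro tendsto_intros assms) auto
  have 2: "((\<lambda>t. collision_prob K q (f t)) \<longlongrightarrow> collision_prob K q x) F"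
    unfolding collision_prob_def by (intro tendsto_intros 1)
  show ?thesis
    using assms(2) by (cases "k = 0")
      (auto simp: flow_def drift_def intro!: tendsto_intros 1 2 assms(1))
qed

section \<open>Differential inequalities on the half-line\<close>

text \<open>Only points near \<open>t\<close> matter, so facts about compact intervals carry over to
  the half-line with its one-sided derivative at 0.\<close>

lemma at_within_halfline:
  fixes t :: real
  assumes "0 \<le> t"
  shows "at t within {0..} = at t within {0..t + 1}"
  by (rule at_within_nhd[of _ "{..<t + 1}"]) auto

lemma has_real_derivative_integral_halfline:
  fixes g :: "real \<Rightarrow> real"
  assumes "continuous_on {0..} g" "0 \<le> t"
  shows "((\<lambda>t. integral {0..t} g) has_real_derivative g t) (at t within {0..})"
  unfolding at_within_halfline[OF assms(2)] using assms
  by (intro integral_has_real_derivative) (auto intro: continuous_on_subset)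

lemma continuous_on_halfline:
  fixes f :: "real \<Rightarrow> real"
  assumes "\<And>b. 0 \<le> b \<Longrightarrow> continuous_on {0..b} f"
  shows "continuous_on {0..} f"
  unfolding continuous_on_eq_continuous_within
proof
  fix t :: real assume "t \<in> {0..}"
  then show "continuous (at t within {0..}) f"
    using assms[of "t + 1"] at_within_halfline[of t] by (auto simp: continuous_on_eq_continuous_within)
qed

lemma continuous_on_integral_halfline:
  fixes g :: "real \<Rightarrow> real"
  assumes "\<And>b. 0 \<le> b \<Longrightarrow> g integrable_on {0..b}"
  shows "continuous_on {0..} (\<lambda>t. integral {0..t} g)"
  by (intro continuous_on_halfline indefinite_integral_continuous_1 assms)

lemma integral_exp_0: "0 \<le> t \<Longrightarrow> integral {0..t} exp = exp t - (1::real)"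
  using fundamental_theorem_of_calculus[of 0 t exp exp]
  by (auto intro!: integral_unique derivative_eq_intros
      simp: has_real_derivative_iff_has_vector_derivative[symmetric])

lemma halfline_increment_ge:
  fixes f f' :: "real \<Rightarrow> real"
  assumes f: "\<And>t. 0 \<le> t \<Longrightarrow> (f has_real_derivative f' t) (at t within {0..})"
    and "0 \<le> a" "a \<le> b" and c: "\<And>t. a \<le> t \<Longrightarrow> t \<le> b \<Longrightarrow> c \<le> f' t"
  shows "c * (b - a) \<le> f b - f a"
proof (cases "a = b")
  case False
  then have "a < b" using assms by simp
  moreover have "(f has_derivative (*) (f' t)) (at t within {a..b})" if "a \<le> t" "t \<le> b" for t
    using f[of t] that assms(2)
    by (auto simp: has_field_derivative_def[symmetric] intro: DERIV_subset)
  ultimately obtain t where "t \<in> {a<..<b}" "f b - f a = f' t * (b - a)"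
    using mvt_simple[of a b f "\<lambda>t. (*) (f' t)"] by auto
  then show ?thesis using c[of t] \<open>a < b\<close> by (simp add: mult_right_mono)
qed simp

text \<open>The product \<open>exp (- C * t) * V t\<close> starts at 0 and has nonpositive
  derivative up to time \<open>b\<close>. Its negative is used because the increment lemma yields
  lower bounds.\<close>

lemma gronwall_zero:
  fixes V V' :: "real \<Rightarrow> real"
  assumes V: "\<And>t. 0 \<le> t \<Longrightarrow> (V has_real_derivative V' t) (at t within {0..})"
    and "V 0 = 0" "0 \<le> b" and C: "\<And>t. 0 \<le> t \<Longrightarrow> t \<le> b \<Longrightarrow> V' t \<le> C * V t"
  shows "V b \<le> 0"
proof -
  let ?f = "\<lambda>t. - (exp (- C * t) * V t)"
  have "0 * (b - 0) \<le> ?f b - ?f 0"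
  proof (rule halfline_increment_ge[where f' = "\<lambda>t. exp (- C * t) * (C * V t - V' t)"])
    fix t :: real assume "0 \<le> t"
    then show "(?f has_real_derivative exp (- C * t) * (C * V t - V' t)) (at t within {0..})"
      by (auto intro!: derivative_eq_intros V simp: algebra_simps)
  qed (use assms in auto)
  then show ?thesis using assms(2) by (simp add: mult_le_0_iff)
qed

text \<open>At multiples of \<open>T\<close> a geometric sequence dominates \<open>W\<close>;
  monotonicity fills the gaps in between.\<close>

lemma contraction_tendsto_0:
  fixes W :: "real \<Rightarrow> real"
  assumes "\<And>t. 0 \<le> t \<Longrightarrow> 0 \<le> W t" and anti: "\<And>s t. 0 \<le> s \<Longrightarrow> 0 \<le> t \<Longrightarrow> W (s + t) \<le> W s"
    and "0 \<le> T" "0 \<le> c" "c < 1" and contr: "\<And>s. 0 \<le> s \<Longrightarrow> W (s + T) \<le> c * W s"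
  shows "(W \<longlongrightarrow> 0) at_top"
proof -
  have W: "W (n * T) \<le> c ^ n * W 0" for n :: nat
  proof (induction n)
    case (Suc n)
    have "W (Suc n * T) = W (n * T + T)" by (simp add: algebra_simps)
    also have "\<dots> \<le> c * W (n * T)" using \<open>0 \<le> T\<close> by (intro contr) simp
    also have "\<dots> \<le> c * (c ^ n * W 0)" using Suc \<open>0 \<le> c\<close> by (intro mult_left_mono)
    finally show ?case by simp
  qed simp
  have "(\<lambda>n. c ^ n * W 0) \<longlonglongrightarrow> 0"
    using assms by (intro tendsto_mult_left_zero LIMSEQ_power_zero) auto
  show ?thesis
  proof (rule tendstoI)
    fix e :: real assume "0 < e"
    with \<open>(\<lambda>n. c ^ n * W 0) \<longlonglongrightarrow> 0\<close> obtain n where n: "c ^ n * W 0 < e"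
      by (metis (lifting) order_tendstoD(2) eventually_sequentially order_refl)
    have "W t < e" "0 \<le> W t" if "n * T \<le> t" for t
    proof -
      have "0 \<le> n * T" using \<open>0 \<le> T\<close> by simp
      then have "W t \<le> W (n * T)" "0 \<le> W t"
        using anti[of "n * T" "t - n * T"] assms(1)[of t] that by auto
      then show "W t < e" "0 \<le> W t" using W[of n] n by auto
    qed
    then show "\<forall>\<^sub>F t in at_top. dist (W t) 0 < e"
      unfolding eventually_at_top_linorder by (intro exI[of _ "n * T"]) auto
  qed
qed

text \<open>By convexity \<open>exp (- b)\<close> lies above the tangent at \<open>a\<close>, whose
  slope is at most \<open>R\<close> in absolute value. Arguments of either sign are covered, as
  needed for solutions not yet known to be nonnegative.\<close>

lemma abs_exp_neg_diff_le:
  fixes u v :: real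
  assumes "exp (- u) \<le> R" "exp (- v) \<le> R"
  shows "\<bar>exp (- u) - exp (- v)\<bar> \<le> R * \<bar>u - v\<bar>"
proof -
  have *: "exp (- a) - exp (- b) \<le> R * \<bar>a - b\<bar>" if "exp (- a) \<le> R" for a b :: real
  proof -
    have "exp (- a) * (1 + (a - b)) \<le> exp (- a) * exp (a - b)"
      by (intro mult_left_mono) auto
    also have "\<dots> = exp (- b)" by (simp add: exp_add[symmetric])
    finally have "exp (- a) - exp (- b) \<le> exp (- a) * (b - a)" by (simp add: algebra_simps)
    also have "\<dots> \<le> exp (- a) * \<bar>a - b\<bar>" by (intro mult_left_mono) auto
    also have "\<dots> \<le> R * \<bar>a - b\<bar>" using that by (intro mult_right_mono) auto
    finally show ?thesis .
  qed
  show ?thesis using *[OF assms(1), of v] *[OF assms(2), of u] by (simp add: abs_minus_commute)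
qed

text \<open>Apart from the decay \<open>exp (- t)\<close>, mass moves one hop along the cycle per
  unit of time, with at least the fraction \<open>e\<close> arriving. Every \<open>j\<close> is at
  most \<open>K\<close> hops from \<open>i\<close>, and waiting out the remaining time costs only
  the decay.\<close>

lemma cyclic_lower_bound:
  fixes p p' :: "real \<Rightarrow> nat \<Rightarrow> real"
  assumes nonneg: "\<And>t k. 0 \<le> t \<Longrightarrow> k \<le> K \<Longrightarrow> 0 \<le> p t k"
    and deriv: "\<And>t k. 0 \<le> t \<Longrightarrow> k \<le> K \<Longrightarrow>
      ((\<lambda>s. p s k) has_real_derivative p' t k) (at t within {0..})"
    and lower: "\<And>t k. 0 \<le> t \<Longrightarrow> k \<le> K \<Longrightarrow> e * p t (pred_mod K k) - p t k \<le> p' t k"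
    and "0 < e" "e \<le> 1" "i \<le> K" "j \<le> K"
  shows "exp (- real K) * e ^ K * p 0 i \<le> p (real K) j"
proof -
  \<comment> \<open>The integrating factor cancels the loss term: each \<open>r t k\<close> is
    nondecreasing and grows at least at rate \<open>e\<close> times its predecessor.\<close>
  define r where "r t k = exp t * p t k" for t k
  have r0: "0 \<le> r t k" if "0 \<le> t" "k \<le> K" for t k using nonneg that by (simp add: r_def)
  have pm: "pred_mod K k \<le> K" if "k \<le> K" for k using that by (auto simp: pred_mod_def)
  have dr: "((\<lambda>s. r s k) has_real_derivative exp t * (p t k + p' t k)) (at t within {0..})"
    if "0 \<le> t" "k \<le> K" for t k
    unfolding r_def by (auto intro!: derivative_eq_intros deriv that simp: algebra_simps)
  have lr: "e * r t (pred_mod K k) \<le> exp t * (p t k + p' t k)" if "0 \<le> t" "k \<le> K" for t k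
  proof -
    have "exp t * (e * p t (pred_mod K k)) \<le> exp t * (p t k + p' t k)"
      using lower[OF that] by (intro mult_left_mono) auto
    then show ?thesis by (simp add: r_def algebra_simps)
  qed
  have mono: "r a k \<le> r b k" if "0 \<le> a" "a \<le> b" "k \<le> K" for a b k
  proof -
    have "0 * (b - a) \<le> r b k - r a k"
    proof (rule halfline_increment_ge[OF dr])
      fix t assume "a \<le> t" "t \<le> b"
      then have "0 \<le> t" using that by simp
      then have "0 \<le> e * r t (pred_mod K k)" using r0[OF _ pm] that \<open>0 < e\<close> by simp
      then show "0 \<le> exp t * (p t k + p' t k)" using lr[OF \<open>0 \<le> t\<close> \<open>k \<le> K\<close>] by simp
    qed (use that in auto)
    then show ?thesis by simp
  qed
  have step: "e * r a (pred_mod K k) \<le> r (a + 1) k" if "0 \<le> a" "k \<le> K" for a k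
  proof -
    have "(e * r a (pred_mod K k)) * (a + 1 - a) \<le> r (a + 1) k - r a k"
    proof (rule halfline_increment_ge[OF dr])
      fix t assume t: "a \<le> t" "t \<le> a + 1"
      have "e * r a (pred_mod K k) \<le> e * r t (pred_mod K k)"
        using mono[OF \<open>0 \<le> a\<close> t(1) pm] that \<open>0 < e\<close> by simp
      then show "e * r a (pred_mod K k) \<le> exp t * (p t k + p' t k)"
        using lr[of t k] that t by simp
    qed (use that in auto)
    then show ?thesis using r0[OF that] by simp
  qed
  have iter: "e ^ n * r 0 i \<le> r (real n) ((i + n) mod Suc K)" for n
  proof (induction n)
    case 0
    then show ?case using \<open>i \<le> K\<close> by simp
  next
    case (Suc n)
    let ?k = "(i + Suc n) mod Suc K"
    have k: "?k \<le> K" using mod_less_divisor[of "Suc K"] less_Suc_eq_le by blast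
    have pk: "pred_mod K ?k = (i + n) mod Suc K"
      by (auto simp: pred_mod_def mod_Suc)
    have "e ^ Suc n * r 0 i \<le> e * r (real n) ((i + n) mod Suc K)"
      using Suc \<open>0 < e\<close> by simp
    also have "\<dots> \<le> r (real n + 1) ?k" using step[OF _ k, of n] by (simp only: pk)
    finally show ?case by (simp add: add.commute)
  qed
  \<comment> \<open>The number of forward hops from \<open>i\<close> to \<open>j\<close> on the
    cycle.\<close>
  define n where "n = (if i \<le> j then j - i else j + Suc K - i)"
  have "i + n = j \<or> i + n = j + Suc K" and n: "n \<le> K"
    using \<open>i \<le> K\<close> \<open>j \<le> K\<close> by (auto simp: n_def)
  then have nj: "(i + n) mod Suc K = j"
    using \<open>j \<le> K\<close> by (auto simp del: add_Suc_right)
  have "e ^ K * r 0 i \<le> e ^ n * r 0 i"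
    using n \<open>0 < e\<close> \<open>e \<le> 1\<close> r0[of 0 i] \<open>i \<le> K\<close> by (intro mult_right_mono power_decreasing) auto
  also have "\<dots> \<le> r (real n) j" using iter[of n] nj by simp
  also have "\<dots> \<le> r (real K) j" using n \<open>j \<le> K\<close> by (intro mono) auto
  finally have "exp (- real K) * (e ^ K * r 0 i) \<le> exp (- real K) * r (real K) j"
    by (intro mult_left_mono) auto
  then show ?thesis by (simp add: r_def exp_minus field_simps)
qed

section \<open>The backoff dynamics\<close>

locale backoff =
  fixes K :: nat and q :: "nat \<Rightarrow> real"
  assumes q_pos: "k \<le> K \<Longrightarrow> 0 < q k" and q_le_1: "k \<le> K \<Longrightarrow> q k \<le> 1"
begin

section \<open>Order structure of the vector field on vectors of mass at most 1\<close>

lemma attempt_rate_mono: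
  "(\<And>k. k \<le> K \<Longrightarrow> x k \<le> y k) \<Longrightarrow> attempt_rate K q x \<le> attempt_rate K q y"
  unfolding attempt_rate_def
  by (intro sum_mono mult_left_mono) (auto intro: less_imp_le q_pos)

text \<open>Keeps the attempt rate in the range where \<open>u * exp (- u)\<close>
  increases.\<close>

lemma attempt_rate_bounds:
  assumes "x \<in> sub_simplex K"
  shows "0 \<le> attempt_rate K q x" "attempt_rate K q x \<le> 1"
proof -
  show "0 \<le> attempt_rate K q x" unfolding attempt_rate_def
    by (intro sum_nonneg mult_nonneg_nonneg sub_simplexD[OF assms] less_imp_le[OF q_pos]) auto
  have "attempt_rate K q x \<le> (\<Sum>k\<le>K. x k)"
    unfolding attempt_rate_def using sub_simplexD(1)[OF assms] q_le_1
    by (intro sum_mono) (simp add: mult_left_le_one_le less_imp_le q_pos)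
  then show "attempt_rate K q x \<le> 1" using sub_simplexD(2)[OF assms] by linarith
qed

text \<open>More precise than monotonicity: it records how much of the predecessor's excess is
  passed on, which later drives the contraction.\<close>

lemma flow_diff_ge:
  assumes "x \<in> sub_simplex K" "y \<in> sub_simplex K" "\<And>k. k \<le> K \<Longrightarrow> x k \<le> y k" "k \<le> K"
  shows "q (pred_mod K k) * collision_prob K q y * (y (pred_mod K k) - x (pred_mod K k))
           - q k * (y k - x k) \<le> flow K q y k - flow K q x k"
proof -
  let ?j = "pred_mod K k"
  have j: "?j \<le> K" using assms(4) by (auto simp: pred_mod_def)
  have "attempt_rate K q x \<le> attempt_rate K q y" by (intro attempt_rate_mono assms)
  then have c: "0 \<le> collision_prob K q y - collision_prob K q x"
    and a: "attempt_rate K q x * exp (- attempt_rate K q x)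
       \<le> attempt_rate K q y * exp (- attempt_rate K q y)"
    using attempt_rate_bounds[OF assms(2)] by (auto simp: collision_prob_def intro: mult_exp_neg_mono)
  \<comment> \<open>The part of the difference due to the higher collision probability at
    \<open>y\<close>; it has the right sign and is dropped.\<close>
  have "0 \<le> q ?j * x ?j * (collision_prob K q y - collision_prob K q x)"
    using c q_pos[OF j] sub_simplexD(1)[OF assms(1) j] by simp
  then show ?thesis
    using a by (cases "k = 0") (auto simp: flow_def drift_def pred_mod_def algebra_simps)
qed

text \<open>No rate exceeds 1, so an Euler step of length 1 removes at most the excess
  \<open>y k - x k\<close> that is already there.\<close>

lemma flow_mono:
  assumes "x \<in> sub_simplex K" "y \<in> sub_simplex K" "\<And>k. k \<le> K \<Longrightarrow> x k \<le> y k" "k \<le> K"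
  shows "x k + flow K q x k \<le> y k + flow K q y k"
proof -
  let ?j = "pred_mod K k"
  have j: "?j \<le> K" using assms(4) by (auto simp: pred_mod_def)
  have "0 \<le> q ?j * collision_prob K q y * (y ?j - x ?j)"
    using q_pos[OF j] assms(3)[OF j] attempt_rate_bounds[OF assms(2)]
    by (simp add: collision_prob_def)
  moreover have "q k * (y k - x k) \<le> y k - x k"
    using q_pos[OF assms(4)] q_le_1[OF assms(4)] assms(3)[OF assms(4)] by (intro mult_left_le_one_le) auto
  ultimately show ?thesis using flow_diff_ge[OF assms] by linarith
qed

text \<open>The step fixes the zero vector, so monotonicity gives nonnegativity; the mass is
  unchanged.\<close>

lemma step_in_sub_simplex:
  assumes "x \<in> sub_simplex K"
  shows "(\<lambda>k. x k + flow K q x k) \<in> sub_simplex K"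
proof -
  have z: "(\<lambda>_. 0) \<in> sub_simplex K" by (simp add: sub_simplex_def)
  have "0 \<le> x k + flow K q x k" if "k \<le> K" for k
    using flow_mono[OF z assms _ that] sub_simplexD(1)[OF assms] that
    by (auto simp: flow_def drift_def attempt_rate_def split: if_splits)
  then show ?thesis using sub_simplexD(2)[OF assms]
    by (simp add: sub_simplex_def sum.distrib sum_flow)
qed

section \<open>Construction of the semiflow by monotone Picard iteration\<close>

text \<open>
  With the integrating factor \<open>exp t\<close>, the integrand is monotone in the state. Starting at 0 makes
  the iterates increase, so that they converge without any Lipschitz estimate.
\<close>

primrec picard :: "(nat \<Rightarrow> real) \<Rightarrow> nat \<Rightarrow> real \<Rightarrow> nat \<Rightarrow> real" where
  "picard y 0 = (\<lambda>t k. 0)"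
| "picard y (Suc n) = (\<lambda>t k. exp (- t) *
     (y k + integral {0..t} (\<lambda>s. exp s * (picard y n s k + flow K q (picard y n s) k))))"

text \<open>Both invariants share one induction: continuity makes the next integrand integrable,
  membership bounds it. The integrals add at most \<open>exp t - 1\<close> to an initial mass of at
  most 1, and the factor \<open>exp (- t)\<close> brings the total back to at most 1.\<close>

lemma picard_invariant:
  assumes y: "y \<in> sub_simplex K"
  shows "(\<forall>k\<le>K. continuous_on {0..} (\<lambda>t. picard y n t k)) \<and>
         (\<forall>t\<ge>0. picard y n t \<in> sub_simplex K)"
proof (induction n)
  case 0
  show ?case by (simp add: sub_simplex_def)
next
  case (Suc n)
  let ?T = "\<lambda>s k. picard y n s k + flow K q (picard y n s) k"
  have c: "continuous_on {0..} (\<lambda>s. exp s * ?T s k)" if "k \<le> K" for k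
    using Suc that by (intro continuous_intros continuous_on_flow) auto
  have i: "(\<lambda>s. exp s * ?T s k) integrable_on {0..b}" if "k \<le> K" for k b
    by (intro integrable_continuous_real continuous_on_subset[OF c[OF that]]) auto
  have T: "?T s \<in> sub_simplex K" if "0 \<le> s" for s
    using Suc that by (intro step_in_sub_simplex) auto
  have "continuous_on {0..} (\<lambda>t. picard y (Suc n) t k)" if "k \<le> K" for k
    by (simp, intro continuous_intros continuous_on_integral_halfline i that)
  moreover have "picard y (Suc n) t \<in> sub_simplex K" if t: "0 \<le> t" for t
    unfolding sub_simplex_def
  proof (intro CollectI conjI allI impI)
    fix k assume k: "k \<le> K"
    have "0 \<le> integral {0..t} (\<lambda>s. exp s * ?T s k)"
      using i[OF k] sub_simplexD(1)[OF T k] by (intro integral_nonneg) auto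
    then show "0 \<le> picard y (Suc n) t k" using sub_simplexD(1)[OF y k] by simp
  next
    have "(\<Sum>k\<le>K. integral {0..t} (\<lambda>s. exp s * ?T s k))
        = integral {0..t} (\<lambda>s. \<Sum>k\<le>K. exp s * ?T s k)"
      using i by (intro integral_sum[symmetric]) auto
    also have "\<dots> \<le> integral {0..t} exp"
    proof (intro integral_le integrable_sum i)
      fix s assume "s \<in> {0..t}"
      then show "(\<Sum>k\<le>K. exp s * ?T s k) \<le> exp s"
        using sub_simplexD(2)[OF T, of s] by (simp add: sum_distrib_left[symmetric])
    next
      show "(exp :: real \<Rightarrow> real) integrable_on {0..t}"
        by (intro integrable_continuous_real continuous_intros)
    qed auto
    also have "\<dots> = exp t - 1" using t by (rule integral_exp_0)
    finally have "(\<Sum>k\<le>K. y k + integral {0..t} (\<lambda>s. exp s * ?T s k)) \<le> exp t"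
      using sub_simplexD(2)[OF y] by (simp add: sum.distrib)
    then have "exp (- t) * (\<Sum>k\<le>K. y k + integral {0..t} (\<lambda>s. exp s * ?T s k))
        \<le> exp (- t) * exp t" by (intro mult_left_mono) auto
    then show "(\<Sum>k\<le>K. picard y (Suc n) t k) \<le> 1"
      by (simp only: picard.simps sum_distrib_left[symmetric]) (simp add: exp_minus)
  qed
  ultimately show ?case by blast
qed

lemmas picard_continuous = picard_invariant[THEN conjunct1, rule_format]
lemmas picard_mem = picard_invariant[THEN conjunct2, rule_format]

lemma picard_step_integrable:
  assumes "y \<in> sub_simplex K" "k \<le> K"
  shows "(\<lambda>s. exp s * (picard y n s k + flow K q (picard y n s) k)) integrable_on {0..t}"
  using assms
  by (intro integrable_continuous_real continuous_intros continuous_on_flow)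
    (auto intro: continuous_on_subset[OF picard_continuous])

text \<open>Varying the starting vector and the index together covers both monotonicity in the
  initial value and growth from one iterate to the next.\<close>

lemma picard_Suc_le:
  assumes y: "y \<in> sub_simplex K" and y': "y' \<in> sub_simplex K"
    and "\<And>k. k \<le> K \<Longrightarrow> y k \<le> y' k"
    and "\<And>s k. 0 \<le> s \<Longrightarrow> k \<le> K \<Longrightarrow> picard y n s k \<le> picard y' n' s k"
    and "0 \<le> t" "k \<le> K"
  shows "picard y (Suc n) t k \<le> picard y' (Suc n') t k"
proof -
  have "integral {0..t} (\<lambda>s. exp s * (picard y n s k + flow K q (picard y n s) k))
    \<le> integral {0..t} (\<lambda>s. exp s * (picard y' n' s k + flow K q (picard y' n' s) k))"
    using assms picard_mem[OF y, of _ n] picard_mem[OF y', of _ n']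
    by (intro integral_le picard_step_integrable mult_left_mono flow_mono) auto
  then show ?thesis using assms(3)[OF \<open>k \<le> K\<close>] by simp
qed

lemma picard_mono_init:
  assumes "y \<in> sub_simplex K" "y' \<in> sub_simplex K"
    and "\<And>k. k \<le> K \<Longrightarrow> y k \<le> y' k" "0 \<le> t" "k \<le> K"
  shows "picard y n t k \<le> picard y' n t k"
  using assms(4,5)
proof (induction n arbitrary: t k)
  case (Suc n)
  then show ?case using assms(1-3) by (intro picard_Suc_le)
qed simp

lemma picard_le_Suc:
  assumes "y \<in> sub_simplex K" "0 \<le> t" "k \<le> K"
  shows "picard y n t k \<le> picard y (Suc n) t k"
  using assms(2,3)
proof (induction n arbitrary: t k)
  case 0
  then show ?case using sub_simplexD(1)[OF picard_mem[OF assms(1) 0(1), of "Suc 0"]] by simp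
next
  case (Suc n)
  then show ?case using assms(1) by (intro picard_Suc_le) auto
qed

lemma sub_simplex_le_1:
  assumes "x \<in> sub_simplex K" "k \<le> K"
  shows "x k \<le> 1"
proof -
  have "x k \<le> (\<Sum>k\<le>K. x k)"
    using assms by (intro member_le_sum) (auto dest: sub_simplexD)
  then show ?thesis using sub_simplexD(2)[OF assms(1)] by linarith
qed

text \<open>Coordinates above \<open>K\<close> are not controlled, so they are cut off to 0 wherever
  a point of \<open>standard_simplex K\<close> is required.\<close>

definition semiflow :: "(nat \<Rightarrow> real) \<Rightarrow> real \<Rightarrow> nat \<Rightarrow> real" where
  "semiflow y t k = lim (\<lambda>n. picard y n t k)"

lemma picard_tendsto_semiflow:
  assumes "y \<in> sub_simplex K" "0 \<le> t" "k \<le> K"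
  shows "(\<lambda>n. picard y n t k) \<longlonglongrightarrow> semiflow y t k"
proof -
  have "incseq (\<lambda>n. picard y n t k)"
    using picard_le_Suc[OF assms] by (rule incseq_SucI)
  moreover have "picard y n t k \<le> 1" for n
    using sub_simplex_le_1[OF picard_mem] assms by blast
  ultimately show ?thesis
    unfolding semiflow_def by (metis incseq_convergent limI)
qed

lemma semiflow_mem:
  assumes "y \<in> sub_simplex K" "0 \<le> t"
  shows "semiflow y t \<in> sub_simplex K"
  unfolding sub_simplex_def
proof (intro CollectI conjI allI impI)
  fix k assume "k \<le> K"
  then show "0 \<le> semiflow y t k"
    using sub_simplexD(1)[OF picard_mem[OF assms]]
    by (intro LIMSEQ_le_const[OF picard_tendsto_semiflow[OF assms]] exI allI impI)
next
  have "(\<lambda>n. \<Sum>k\<le>K. picard y n t k) \<longlonglongrightarrow> (\<Sum>k\<le>K. semiflow y t k)"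
    by (intro tendsto_sum picard_tendsto_semiflow assms) auto
  then show "(\<Sum>k\<le>K. semiflow y t k) \<le> 1"
    using sub_simplexD(2)[OF picard_mem[OF assms]] by (intro LIMSEQ_le_const2) auto
qed

lemma semiflow_mono:
  assumes "y \<in> sub_simplex K" "y' \<in> sub_simplex K"
    and "\<And>k. k \<le> K \<Longrightarrow> y k \<le> y' k" "0 \<le> t" "k \<le> K"
  shows "semiflow y t k \<le> semiflow y' t k"
  using picard_tendsto_semiflow[OF assms(1,4,5)] picard_tendsto_semiflow[OF assms(2,4,5)]
    picard_mono_init[OF assms]
  by (intro LIMSEQ_le) auto

text \<open>Passage to the limit in the Picard recursion by dominated convergence. A step from a
  point of \<open>sub_simplex K\<close> has its coordinates up to \<open>K\<close> in
  \<open>[0, 1]\<close>, so \<open>exp\<close> dominates all integrands.\<close>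

lemma
  assumes y: "y \<in> sub_simplex K" and t: "0 \<le> t" and k: "k \<le> K"
  shows semiflow_step_integrable:
      "(\<lambda>s. exp s * (semiflow y s k + flow K q (semiflow y s) k)) integrable_on {0..t}"
    and semiflow_eq: "semiflow y t k = exp (- t) *
      (y k + integral {0..t} (\<lambda>s. exp s * (semiflow y s k + flow K q (semiflow y s) k)))"
proof -
  let ?f = "\<lambda>n s. exp s * (picard y n s k + flow K q (picard y n s) k)"
  let ?g = "\<lambda>s. exp s * (semiflow y s k + flow K q (semiflow y s) k)"
  have bound: "norm (?f n s) \<le> exp s" if "s \<in> {0..t}" for n s
  proof -
    have "(\<lambda>k. picard y n s k + flow K q (picard y n s) k) \<in> sub_simplex K"
      using that by (intro step_in_sub_simplex picard_mem y) auto
    from sub_simplexD(1)[OF this k] sub_simplex_le_1[OF this k] show ?thesis by simp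
  qed
  have "exp integrable_on {0..t}"
    by (intro integrable_continuous_real continuous_intros)
  moreover have "(\<lambda>n. ?f n s) \<longlonglongrightarrow> ?g s" if "s \<in> {0..t}" for s
    using that k by (intro tendsto_intros tendsto_flow picard_tendsto_semiflow y) auto
  ultimately have "?g integrable_on {0..t}"
    and int: "(\<lambda>n. integral {0..t} (?f n)) \<longlonglongrightarrow> integral {0..t} ?g"
    using bound by (intro dominated_convergence[of ?f "{0..t}" exp ?g]
        picard_step_integrable y k; blast)+
  then show "?g integrable_on {0..t}" by simp
  have "(\<lambda>n. picard y (Suc n) t k) \<longlonglongrightarrow> exp (- t) * (y k + integral {0..t} ?g)"
    unfolding picard.simps by (intro tendsto_intros int)
  then show "semiflow y t k = exp (- t) * (y k + integral {0..t} ?g)"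
    using LIMSEQ_Suc[OF picard_tendsto_semiflow[OF y t k]] LIMSEQ_unique by blast
qed

lemma semiflow_0: "y \<in> sub_simplex K \<Longrightarrow> k \<le> K \<Longrightarrow> semiflow y 0 k = y k"
  by (subst semiflow_eq) auto

text \<open>A pointwise limit need not be continuous, but the integral equation makes this one so,
  as an indefinite integral of an integrable function is continuous.\<close>

lemma semiflow_continuous:
  assumes "y \<in> sub_simplex K" "k \<le> K"
  shows "continuous_on {0..} (\<lambda>t. semiflow y t k)"
proof -
  have "continuous_on {0..} (\<lambda>t. exp (- t) *
      (y k + integral {0..t} (\<lambda>s. exp s * (semiflow y s k + flow K q (semiflow y s) k))))"
    by (intro continuous_intros continuous_on_integral_halfline semiflow_step_integrable assms)
  then show ?thesis
    by (rule continuous_on_cong[THEN iffD1, rotated -1])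
      (simp_all add: semiflow_eq[OF assms(1) _ assms(2), symmetric])
qed

text \<open>Continuity of the semiflow makes the integrand continuous, so the integral equation can
  be differentiated.\<close>

lemma semiflow_has_derivative:
  assumes y: "y \<in> sub_simplex K" and t: "0 \<le> t" and k: "k \<le> K"
  shows "((\<lambda>t. semiflow y t k) has_real_derivative flow K q (semiflow y t) k) (at t within {0..})"
proof -
  let ?g = "\<lambda>s. exp s * (semiflow y s k + flow K q (semiflow y s) k)"
  have "continuous_on {0..} ?g"
    by (intro continuous_intros continuous_on_flow semiflow_continuous y k) auto
  then have "((\<lambda>t. exp (- t) * (y k + integral {0..t} ?g)) has_real_derivative
     exp (- t) * ?g t - exp (- t) * (y k + integral {0..t} ?g)) (at t within {0..})"
    by (auto intro!: derivative_eq_intros has_real_derivative_integral_halfline t)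
  moreover have "exp (- t) * ?g t - exp (- t) * (y k + integral {0..t} ?g) = flow K q (semiflow y t) k"
    unfolding semiflow_eq[OF y t k, symmetric] by (simp add: exp_minus field_simps)
  ultimately show ?thesis
    using semiflow_eq[OF y _ k] t
    by (auto intro: has_field_derivative_transform_within[where d = 1])
qed


section \<open>Uniqueness of solutions, the semigroup law and conservation of mass\<close>

text \<open>A Gronwall argument for the squared distance. Only \<open>g\<close> is known to stay in
  \<open>sub_simplex K\<close>; \<open>f\<close> may be an arbitrary solution, which is how
  invariance of the simplex is obtained later.\<close>

lemma derivative_unique:
  assumes f: "\<And>t k. 0 \<le> t \<Longrightarrow> k \<le> K \<Longrightarrow>
      ((\<lambda>s. f s k) has_real_derivative flow K q (f t) k) (at t within {0..})"
    and g: "\<And>t k. 0 \<le> t \<Longrightarrow> k \<le> K \<Longrightarrow>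
      ((\<lambda>s. g s k) has_real_derivative flow K q (g t) k) (at t within {0..})"
    and g_mem: "\<And>t. 0 \<le> t \<Longrightarrow> g t \<in> sub_simplex K"
    and init: "\<And>k. k \<le> K \<Longrightarrow> f 0 k = g 0 k"
    and b: "0 \<le> b" and k: "k \<le> K"
  shows "f b k = g b k"
proof -
  \<comment> \<open>The attempt rate of \<open>f\<close> could be negative, so its exponential is
    bounded by compactness of \<open>{0..b}\<close>.\<close>
  have "continuous_on {0..b} (\<lambda>t. f t k)" if "k \<le> K" for k
    by (rule DERIV_continuous_on[of _ _ "\<lambda>t. flow K q (f t) k"])
      (auto intro: DERIV_subset[OF f] that)
  then have "continuous_on {0..b} (\<lambda>t. exp (- attempt_rate K q (f t)))"
    unfolding attempt_rate_def by (intro continuous_intros) auto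
  then have "bounded ((\<lambda>t. exp (- attempt_rate K q (f t))) ` {0..b})"
    by (intro compact_imp_bounded compact_continuous_image) auto
  then obtain R0 where R0: "\<And>t. t \<in> {0..b} \<Longrightarrow> exp (- attempt_rate K q (f t)) \<le> R0"
    unfolding bounded_iff by (metis image_eqI real_norm_def abs_le_D1)
  define R where "R = max R0 1"
  \<comment> \<open>\<open>S\<close> suits the Lipschitz estimate, while \<open>V\<close> uses
    squares in order to be differentiable. In \<open>C\<close>, the factor \<open>2 + 2 * R\<close>
    collects the bounds \<open>1 + R\<close>, \<open>R\<close> and \<open>1\<close> for the three
    terms of a drift difference; \<open>1 + real K\<close> covers the \<open>K\<close> drifts summed
    in coordinate 0.\<close>
  define S where "S t = (\<Sum>k\<le>K. \<bar>f t k - g t k\<bar>)" for t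
  define C where "C = (1 + real K) * (2 + 2 * R)"
  define V where "V t = (\<Sum>k\<le>K. (f t k - g t k)\<^sup>2)" for t
  define V' where "V' t = (\<Sum>k\<le>K. 2 * (f t k - g t k) * (flow K q (f t) k - flow K q (g t) k))" for t
  have R1: "1 \<le> R" by (simp add: R_def)
  have S_nonneg: "0 \<le> S t" for t by (auto simp: S_def intro: sum_nonneg)
  have S_ge: "\<bar>f t k - g t k\<bar> \<le> S t" if "k \<le> K" for t k
    unfolding S_def using that by (intro member_le_sum) auto
  have lipschitz: "\<bar>flow K q (f t) k - flow K q (g t) k\<bar> \<le> C * S t"
    if t: "0 \<le> t" "t \<le> b" and k: "k \<le> K" for t k
  proof -
    let ?x = "f t" and ?y = "g t"
    let ?a = "attempt_rate K q"
    let ?c = "collision_prob K q"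
    have ea: "exp (- ?a ?x) \<le> R" using R0[of t] t by (simp add: R_def)
    have "exp (- ?a ?y) \<le> 1" using attempt_rate_bounds(1)[OF g_mem[OF t(1)]] by simp
    then have eb: "exp (- ?a ?y) \<le> R" using R1 by linarith
    have "?a ?x - ?a ?y = (\<Sum>k\<le>K. q k * (?x k - ?y k))"
      by (simp add: attempt_rate_def sum_subtractf right_diff_distrib)
    also have "\<bar>\<dots>\<bar> \<le> (\<Sum>k\<le>K. \<bar>q k * (?x k - ?y k)\<bar>)" by (rule sum_abs)
    also have "\<dots> \<le> S t" unfolding S_def
      by (intro sum_mono) (simp add: abs_mult q_pos q_le_1 mult_left_le_one_le less_imp_le)
    finally have "\<bar>?a ?x - ?a ?y\<bar> \<le> S t" .
    then have "R * \<bar>?a ?x - ?a ?y\<bar> \<le> R * S t" using R1 by (intro mult_left_mono) auto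
    then have cc: "\<bar>?c ?x - ?c ?y\<bar> \<le> R * S t"
      using abs_exp_neg_diff_le[OF ea eb] by (simp add: collision_prob_def abs_minus_commute)
    have c: "\<bar>?c ?x\<bar> \<le> 1 + R" using ea R1 exp_gt_zero[of "- ?a ?x"]
      unfolding collision_prob_def by (simp only: abs_le_iff) linarith
    have drift: "\<bar>drift K q ?x k - drift K q ?y k\<bar> \<le> (2 + 2 * R) * S t" if "k \<in> {1..K}" for k
    proof -
      let ?j = "k - 1"
      have j: "?j \<le> K" and kK: "k \<le> K" using that by auto
      \<comment> \<open>In this splitting the difference of collision probabilities meets a
        coordinate of \<open>?y\<close>, which is at most 1, and not one of
        \<open>?x\<close>.\<close>
      have "drift K q ?x k - drift K q ?y k = q ?j * (?x ?j - ?y ?j) * ?c ?x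
          + q ?j * ?y ?j * (?c ?x - ?c ?y) - q k * (?x k - ?y k)"
        by (simp add: drift_def algebra_simps)
      moreover have "\<bar>q ?j * (?x ?j - ?y ?j) * ?c ?x\<bar> \<le> 1 * S t * (1 + R)"
        unfolding abs_mult using q_pos[OF j] q_le_1[OF j] S_ge[OF j] c S_nonneg
        by (intro mult_mono) auto
      moreover have "\<bar>q ?j * ?y ?j * (?c ?x - ?c ?y)\<bar> \<le> 1 * 1 * (R * S t)"
        unfolding abs_mult
        using q_pos[OF j] q_le_1[OF j] cc sub_simplexD(1)[OF g_mem[OF t(1)] j]
          sub_simplex_le_1[OF g_mem[OF t(1)] j]
        by (intro mult_mono) auto
      moreover have "\<bar>q k * (?x k - ?y k)\<bar> \<le> 1 * S t"
        unfolding abs_mult using q_pos[OF kK] q_le_1[OF kK] S_ge[OF kK]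
        by (intro mult_mono) auto
      ultimately have "\<bar>drift K q ?x k - drift K q ?y k\<bar> \<le> 1 * S t * (1 + R) + 1 * 1 * (R * S t) + 1 * S t"
        by linarith
      then show ?thesis by (simp add: algebra_simps)
    qed
    show ?thesis
    proof (cases "k = 0")
      case True
      have "\<bar>flow K q ?x k - flow K q ?y k\<bar> = \<bar>\<Sum>k=1..K. drift K q ?x k - drift K q ?y k\<bar>"
        unfolding sum_subtractf sum_drift True by simp
      also have "\<dots> \<le> (\<Sum>k=1..K. (2 + 2 * R) * S t)"
        by (intro order_trans[OF sum_abs] sum_mono drift)
      also have "\<dots> \<le> C * S t"
        using S_nonneg[of t] R1 by (simp add: C_def algebra_simps)
      finally show ?thesis .
    next
      case False
      then have "\<bar>flow K q ?x k - flow K q ?y k\<bar> \<le> (2 + 2 * R) * S t"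
        using drift[of k] k by (simp add: flow_def)
      also have "\<dots> \<le> C * S t"
        using S_nonneg[of t] R1 by (intro mult_right_mono) (auto simp: C_def)
      finally show ?thesis .
    qed
  qed
  have C0: "0 \<le> C" using R1 by (simp add: C_def)
  have "V b \<le> 0"
  proof (rule gronwall_zero[where V = V and b = b and V' = V' and C = "2 * C * (1 + real K)"])
    fix t :: real assume t: "0 \<le> t"
    have "((\<lambda>s. (f s k - g s k)\<^sup>2) has_real_derivative
        2 * (f t k - g t k) * (flow K q (f t) k - flow K q (g t) k)) (at t within {0..})"
      if "k \<le> K" for k
      using DERIV_power[OF DERIV_diff[OF f[OF t that] g[OF t that]], of 2]
      by (simp add: mult_ac del: right_diff_distrib_numeral)
    then show "(V has_real_derivative V' t) (at t within {0..})"
      unfolding V_def V'_def by (intro DERIV_sum) auto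
  next
    show "V 0 = 0" by (simp add: V_def init)
  next
    fix t assume t: "0 \<le> t" "t \<le> b"
    have "V' t \<le> (\<Sum>k\<le>K. 2 * \<bar>f t k - g t k\<bar> * (C * S t))"
      unfolding V'_def
    proof (rule sum_mono)
      fix k assume "k \<in> {..K}"
      have "2 * (f t k - g t k) * (flow K q (f t) k - flow K q (g t) k)
          \<le> \<bar>2 * (f t k - g t k)\<bar> * \<bar>flow K q (f t) k - flow K q (g t) k\<bar>"
        unfolding abs_mult[symmetric] by (rule abs_ge_self)
      also have "\<dots> \<le> \<bar>2 * (f t k - g t k)\<bar> * (C * S t)"
        using lipschitz[OF t] \<open>k \<in> {..K}\<close> by (intro mult_left_mono) auto
      finally show "2 * (f t k - g t k) * (flow K q (f t) k - flow K q (g t) k)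
          \<le> 2 * \<bar>f t k - g t k\<bar> * (C * S t)" by (simp only: abs_mult abs_numeral)
    qed
    also have "\<dots> = 2 * C * (S t)\<^sup>2"
      unfolding sum_distrib_right[symmetric] sum_distrib_left[symmetric] S_def[symmetric]
      by (simp add: power2_eq_square)
    \<comment> \<open>Cauchy-Schwarz over the \<open>K + 1\<close> coordinates returns from
      \<open>S\<close> to \<open>V\<close>.\<close>
    also have "\<dots> \<le> 2 * C * ((1 + real K) * V t)"
    proof (intro mult_left_mono)
      have "(S t)\<^sup>2 \<le> (\<Sum>k\<le>K. \<bar>f t k - g t k\<bar>\<^sup>2) * card {..K}"
        unfolding S_def by (rule sum_squared_le_sum_of_squares)
      then show "(S t)\<^sup>2 \<le> (1 + real K) * V t" by (simp add: V_def mult.commute)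
    qed (use C0 in auto)
    finally show "V' t \<le> 2 * C * (1 + real K) * V t" by simp
  qed (rule b)
  moreover have "(f b k - g b k)\<^sup>2 \<le> V b"
    unfolding V_def using k by (intro member_le_sum) auto
  ultimately have "(f b k - g b k)\<^sup>2 \<le> 0" by linarith
  then show ?thesis by simp
qed


text \<open>The time-shifted semiflow solves the same autonomous equation from
  \<open>semiflow y s\<close>, so uniqueness applies.\<close>

lemma semiflow_semigroup:
  assumes y: "y \<in> sub_simplex K" and s: "0 \<le> s" and t: "0 \<le> t" and k: "k \<le> K"
  shows "semiflow y (s + t) k = semiflow (semiflow y s) t k"
proof (rule derivative_unique[OF _ _ _ _ t k, where f = "\<lambda>t. semiflow y (s + t)"])
  fix t :: real and k assume *: "0 \<le> t" "k \<le> K"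
  have "((\<lambda>t. semiflow y t k) has_real_derivative flow K q (semiflow y (s + t)) k)
      (at (s + t) within (+) s ` {0..})"
    using s * by (intro DERIV_subset[OF semiflow_has_derivative[OF y]]) auto
  then show "((\<lambda>t. semiflow y (s + t) k) has_real_derivative flow K q (semiflow y (s + t)) k)
      (at t within {0..})"
    by (simp only: DERIV_at_within_shift)
qed (use semiflow_mem[OF y s] in \<open>auto intro: semiflow_has_derivative semiflow_mem simp: semiflow_0\<close>)

lemma semiflow_sum:
  assumes y: "y \<in> sub_simplex K" and t: "0 \<le> t"
  shows "(\<Sum>k\<le>K. semiflow y t k) = (\<Sum>k\<le>K. y k)"
proof -
  have d: "((\<lambda>t. \<Sum>k\<le>K. semiflow y t k) has_real_derivative 0) (at t within {0..})"
    if "0 \<le> t" for t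
    using that by (auto intro!: derivative_eq_intros semiflow_has_derivative y simp: sum_flow)
  from DERIV_minus[OF d] have d': "((\<lambda>t. - (\<Sum>k\<le>K. semiflow y t k)) has_real_derivative 0) (at t within {0..})"
    if "0 \<le> t" for t using that by simp
  show ?thesis
    using halfline_increment_ge[OF d order_refl t, of 0] halfline_increment_ge[OF d' order_refl t, of 0]
    by (simp add: semiflow_0[OF y])
qed

section \<open>Nonexpansiveness and strict contraction in the l1 norm\<close>

definition l1_dist :: "(nat \<Rightarrow> real) \<Rightarrow> (nat \<Rightarrow> real) \<Rightarrow> real" where
  "l1_dist x y = (\<Sum>k\<le>K. \<bar>x k - y k\<bar>)"

lemma meet_mem: "x \<in> sub_simplex K \<Longrightarrow> y \<in> sub_simplex K \<Longrightarrow> (\<lambda>k. min (x k) (y k)) \<in> sub_simplex K"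
  by (auto simp: sub_simplex_def intro!: order_trans[OF sum_mono[of "{..K}" _ x]])

lemma l1_dist_meet:
  "l1_dist x y = (\<Sum>k\<le>K. x k - min (x k) (y k)) + (\<Sum>k\<le>K. y k - min (x k) (y k))"
  unfolding l1_dist_def sum.distrib[symmetric] by (intro sum.cong) auto

text \<open>Both trajectories stay above that of the meet, so the distance is at most the sum of the
  two excesses, and conservation of mass keeps each of these constant.\<close>

lemma semiflow_nonexpansive:
  assumes x: "x \<in> sub_simplex K" and y: "y \<in> sub_simplex K" and t: "0 \<le> t"
  shows "l1_dist (semiflow x t) (semiflow y t) \<le> l1_dist x y"
proof -
  let ?z = "\<lambda>k. min (x k) (y k)"
  note z = meet_mem[OF x y]
  have "l1_dist (semiflow x t) (semiflow y t)
      \<le> (\<Sum>k\<le>K. (semiflow x t k - semiflow ?z t k) + (semiflow y t k - semiflow ?z t k))"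
    unfolding l1_dist_def
  proof (rule sum_mono)
    fix k assume "k \<in> {..K}"
    then show "\<bar>semiflow x t k - semiflow y t k\<bar>
        \<le> (semiflow x t k - semiflow ?z t k) + (semiflow y t k - semiflow ?z t k)"
      using semiflow_mono[OF z x _ t, of k] semiflow_mono[OF z y _ t, of k] by auto
  qed
  also have "\<dots> = l1_dist x y"
    by (simp add: l1_dist_meet sum.distrib sum_subtractf semiflow_sum x y z t
        sum_distrib_left[symmetric])
  finally show ?thesis .
qed

text \<open>If \<open>a\<close> is the smallest rate, total mass exactly 1 forces the attempt rate
  to be at least \<open>a\<close>; hence \<open>a * (1 - exp (- a))\<close> serves as
  \<open>e\<close>.\<close>

lemma forward_rate_lower_bound:
  obtains e where "0 < e" "e \<le> 1"
    "\<And>x k. x \<in> standard_simplex K \<Longrightarrow> k \<le> K \<Longrightarrow> e \<le> q k * collision_prob K q x"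
proof
  define a where "a = Min (q ` {..K})"
  have "a \<in> q ` {..K}" unfolding a_def by (intro Min_in) auto
  then have a: "0 < a" "a \<le> 1" using q_pos q_le_1 by auto
  have a_le: "a \<le> q k" if "k \<le> K" for k using that by (auto simp: a_def)
  show "0 < a * (1 - exp (- a))" using a by simp
  show "a * (1 - exp (- a)) \<le> 1" using a by (intro mult_le_one) auto
  fix x k assume x: "x \<in> standard_simplex K" and k: "k \<le> K"
  have "a * (\<Sum>k\<le>K. x k) \<le> attempt_rate K q x"
    unfolding attempt_rate_def sum_distrib_left using x a_le
    by (intro sum_mono mult_right_mono) (auto simp: standard_simplex_def)
  then have "1 - exp (- a) \<le> collision_prob K q x"
    using x by (simp add: collision_prob_def standard_simplex_def)
  then show "a * (1 - exp (- a)) \<le> q k * collision_prob K q x"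
    using a_le[OF k] a by (intro mult_mono) auto
qed

lemma semiflow_standard_simplex:
  assumes "y \<in> standard_simplex K" "0 \<le> t"
  shows "(\<lambda>k. if k \<le> K then semiflow y t k else 0) \<in> standard_simplex K"
proof -
  have y: "y \<in> sub_simplex K" using assms standard_simplex_sub by auto
  then show ?thesis
    using assms semiflow_sum[OF y] sub_simplexD(1)[OF semiflow_mem[OF y]]
      sub_simplex_le_1[OF semiflow_mem[OF y]]
    by (auto simp: standard_simplex_def)
qed

text \<open>The two excesses over the meet overlap in every coordinate by time \<open>K\<close>, and
  the overlap cancels in the distance.\<close>

lemma semiflow_contraction:
  obtains c where "0 \<le> c" "c < 1"
    "\<And>x y. x \<in> standard_simplex K \<Longrightarrow> y \<in> standard_simplex K \<Longrightarrow>
      l1_dist (semiflow x K) (semiflow y K) \<le> c * l1_dist x y"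
proof -
  obtain e where e: "0 < e" "e \<le> 1"
    "\<And>x k. x \<in> standard_simplex K \<Longrightarrow> k \<le> K \<Longrightarrow> e \<le> q k * collision_prob K q x"
    using forward_rate_lower_bound by metis
  define c where "c = exp (- real K) * e ^ K"
  have c: "0 < c" "c \<le> 1" using e by (simp_all add: c_def mult_le_one power_le_one)
  \<comment> \<open>Averaging the cyclic bound over all sources \<open>i\<close>: each coordinate
    ends with at least the share \<open>c / (1 + real K)\<close> of the total initial
    excess.\<close>
  have spread: "c * (\<Sum>i\<le>K. x i - z i) \<le> (1 + real K) * (semiflow x K j - semiflow z K j)"
    if x: "x \<in> standard_simplex K" and z: "z \<in> sub_simplex K"
      and le: "\<And>k. k \<le> K \<Longrightarrow> z k \<le> x k" and j: "j \<le> K" for x z j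
  proof -
    have x': "x \<in> sub_simplex K" using x standard_simplex_sub by auto
    have "c * (x i - z i) \<le> semiflow x K j - semiflow z K j" if i: "i \<le> K" for i
    proof -
      let ?p = "\<lambda>t k. semiflow x t k - semiflow z t k"
      have "exp (- real K) * e ^ K * ?p 0 i \<le> ?p (real K) j"
      proof (rule cyclic_lower_bound[where p = ?p
            and p' = "\<lambda>t k. flow K q (semiflow x t) k - flow K q (semiflow z t) k"])
        fix t :: real and k assume t: "0 \<le> t" and k: "k \<le> K"
        have mono: "semiflow z t k \<le> semiflow x t k" if "k \<le> K" for k
          by (rule semiflow_mono[OF z x' le t that])
        then show "0 \<le> ?p t k" using k by simp
        show "((\<lambda>s. ?p s k) has_real_derivative
            flow K q (semiflow x t) k - flow K q (semiflow z t) k) (at t within {0..})"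
          by (intro derivative_intros semiflow_has_derivative x' z t k)
        let ?j = "pred_mod K k"
        have pk: "?j \<le> K" using k by (auto simp: pred_mod_def)
        have "e \<le> q ?j * collision_prob K q (semiflow x t)"
        proof (rule order_trans)
          \<comment> \<open>The rate bound is stated for probability vectors, hence the cut-off; the
            attempt rate reads only coordinates up to \<open>K\<close>.\<close>
          let ?y = "\<lambda>k. if k \<le> K then semiflow x t k else 0"
          from e(3)[OF semiflow_standard_simplex[OF x t] pk] show "e \<le> q ?j * collision_prob K q ?y" .
          show "q ?j * collision_prob K q ?y \<le> q ?j * collision_prob K q (semiflow x t)"
            by (simp add: collision_prob_def attempt_rate_def)
        qed
        then have "e * ?p t ?j \<le> q ?j * collision_prob K q (semiflow x t) * ?p t ?j"
          using mono[OF pk] by (intro mult_right_mono) auto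
        moreover have "q k * ?p t k \<le> ?p t k"
          using q_pos[OF k] q_le_1[OF k] mono[OF k] by (intro mult_left_le_one_le) auto
        ultimately show "e * ?p t ?j - ?p t k
            \<le> flow K q (semiflow x t) k - flow K q (semiflow z t) k"
          using flow_diff_ge[OF semiflow_mem[OF z t] semiflow_mem[OF x' t] mono k] by linarith
      qed (use e i j in auto)
      then show ?thesis by (simp add: c_def semiflow_0 x' z i)
    qed
    then have "(\<Sum>i\<le>K. c * (x i - z i)) \<le> (\<Sum>i\<le>K. semiflow x K j - semiflow z K j)"
      by (intro sum_mono) auto
    then show ?thesis by (simp add: sum_distrib_left)
  qed
  show ?thesis
  proof (rule that[of "1 - c"])
    fix x y assume xs: "x \<in> standard_simplex K" and ys: "y \<in> standard_simplex K"
    then have x: "x \<in> sub_simplex K" and y: "y \<in> sub_simplex K" using standard_simplex_sub by auto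
    let ?z = "\<lambda>k. min (x k) (y k)"
    note z = meet_mem[OF x y]
    let ?X = "semiflow x K" and ?Y = "semiflow y K" and ?Z = "semiflow ?z K"
    define d where "d = (\<Sum>k\<le>K. x k - ?z k)"
    \<comment> \<open>Both vectors have mass 1, so both excesses equal \<open>d\<close> and the
      distance is \<open>2 * d\<close>.\<close>
    have d': "(\<Sum>k\<le>K. y k - ?z k) = d"
      using xs ys by (simp add: d_def sum_subtractf standard_simplex_def)
    \<comment> \<open>The common part \<open>c * d / (1 + real K)\<close> is subtracted from both
      excesses. Over \<open>K + 1\<close> coordinates this saves \<open>2 * c * d\<close>, which is
      \<open>c\<close> times the initial distance.\<close>
    have "l1_dist ?X ?Y \<le> (\<Sum>k\<le>K. (?X k - ?Z k) + (?Y k - ?Z k) - 2 * (c * d / (1 + real K)))"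
      unfolding l1_dist_def
    proof (rule sum_mono)
      fix k assume k: "k \<in> {..K}"
      have "c * d / (1 + real K) \<le> ?X k - ?Z k" "c * d / (1 + real K) \<le> ?Y k - ?Z k"
        using spread[OF xs z, of k] spread[OF ys z, of k] k
        unfolding d' d_def[symmetric] by (auto simp: pos_divide_le_eq mult.commute)
      then show "\<bar>?X k - ?Y k\<bar> \<le> (?X k - ?Z k) + (?Y k - ?Z k) - 2 * (c * d / (1 + real K))"
        by linarith
    qed
    also have "\<dots> = l1_dist x y - 2 * c * d"
      by (simp add: l1_dist_meet sum.distrib sum_subtractf semiflow_sum x y z
          sum_distrib_left[symmetric])
    also have "\<dots> = (1 - c) * l1_dist x y"
      unfolding l1_dist_meet d' d_def[symmetric] by (simp add: algebra_simps)
    finally show "l1_dist ?X ?Y \<le> (1 - c) * l1_dist x y" .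
  qed (use c in auto)
qed

section \<open>Solutions of the differential equation and global stability\<close>

text \<open>Turns the \<open>K\<close> equations with their mass constraint into the autonomous
  system for \<open>flow\<close>, by differentiating the constraint for coordinate 0.\<close>

lemma ode_solution_has_derivative:
  assumes "ode_solution K q \<phi>" "0 \<le> t" "k \<le> K"
  shows "((\<lambda>s. \<phi> s k) has_real_derivative flow K q (\<phi> t) k) (at t within {0..})"
proof (cases "k = 0")
  case False
  then show ?thesis using assms by (auto simp: ode_solution_def flow_def)
next
  case True
  have "((\<lambda>s. 1 - (\<Sum>k=1..K. \<phi> s k)) has_real_derivative - (\<Sum>k=1..K. drift K q (\<phi> t) k))
      (at t within {0..})"
    using assms by (auto intro!: derivative_eq_intros simp: ode_solution_def)
  then have "((\<lambda>s. 1 - (\<Sum>k=1..K. \<phi> s k)) has_real_derivative flow K q (\<phi> t) k) (at t within {0..})"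
    by (simp only: sum_drift True minus_minus)
  then show ?thesis using assms True
    by (auto simp: ode_solution_def intro: has_field_derivative_transform_within[where d = 1])
qed

lemma ode_solution_eq_semiflow:
  assumes "ode_solution K q \<phi>" "\<phi> 0 \<in> standard_simplex K" "0 \<le> t" "k \<le> K"
  shows "\<phi> t k = semiflow (\<phi> 0) t k"
proof -
  have "\<phi> 0 \<in> sub_simplex K" using assms standard_simplex_sub by auto
  then show ?thesis
    by (intro derivative_unique[OF ode_solution_has_derivative[OF assms(1)] semiflow_has_derivative
          semiflow_mem semiflow_0[symmetric] assms(3,4)])
qed

lemma ode_solution_semiflow:
  assumes y: "y \<in> standard_simplex K"
  shows "ode_solution K q (\<lambda>t k. if k \<le> K then semiflow y t k else 0)"
proof -
  let ?u = "\<lambda>t k. if k \<le> K then semiflow y t k else 0"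
  have y': "y \<in> sub_simplex K" using assms standard_simplex_sub by auto
  have "?u t 0 = 1 - (\<Sum>k=1..K. ?u t k)" if "0 \<le> t" for t
    using semiflow_standard_simplex[OF y that]
    by (auto simp: standard_simplex_def atMost_atLeast0 sum.atLeast_Suc_atMost)
  moreover have "((\<lambda>s. ?u s k) has_real_derivative drift K q (?u t) k) (at t within {0..})"
    if "0 \<le> t" "k \<in> {1..K}" for t k
  proof -
    have "flow K q (semiflow y t) k = drift K q (?u t) k"
      using that by (auto simp: flow_def drift_def collision_prob_def attempt_rate_def)
    then show ?thesis using semiflow_has_derivative[OF y' that(1), of k] that by auto
  qed
  ultimately show ?thesis by (auto simp: ode_solution_def)
qed

text \<open>The constant function is a solution, because coordinate 0 of \<open>flow\<close> is
  minus the sum of the vanishing drifts; uniqueness does the rest.\<close>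

lemma semiflow_equilibrium:
  assumes "equilibrium K q x" "0 \<le> t" "k \<le> K"
  shows "semiflow x t k = x k"
proof -
  have x: "x \<in> sub_simplex K" using assms standard_simplex_sub by (auto simp: equilibrium_def)
  have "flow K q x k = 0" if "k \<le> K" for k
    using assms(1) that sum_drift[of K q x]
    by (cases "k = 0") (auto simp: equilibrium_def flow_def)
  then have "((\<lambda>s. x k) has_real_derivative flow K q x k) (at t within {0..})"
    if "k \<le> K" for t k using that by simp
  then have "x k = semiflow x t k"
    by (rule derivative_unique[where f = "\<lambda>_. x", OF _ semiflow_has_derivative[OF x]
          semiflow_mem[OF x] semiflow_0[OF x, symmetric] assms(2,3)])
  then show ?thesis by simp
qed

lemma semiflow_tendsto_equilibrium:
  assumes x: "equilibrium K q x" and y: "y \<in> standard_simplex K" and k: "k \<le> K"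
  shows "((\<lambda>t. semiflow y t k) \<longlongrightarrow> x k) at_top"
proof -
  obtain c where c: "0 \<le> c" "c < 1"
    "\<And>x y. x \<in> standard_simplex K \<Longrightarrow> y \<in> standard_simplex K \<Longrightarrow>
      l1_dist (semiflow x K) (semiflow y K) \<le> c * l1_dist x y"
    using semiflow_contraction by metis
  have xs: "x \<in> standard_simplex K" using x by (simp add: equilibrium_def)
  then have x': "x \<in> sub_simplex K" and y': "y \<in> sub_simplex K" using y standard_simplex_sub by auto
  let ?W = "\<lambda>t. l1_dist (semiflow y t) x"
  \<comment> \<open>The equilibrium is stationary, so the distance to it is a distance between two
    trajectories and the l1 estimates apply from any time \<open>s\<close>.\<close>
  have restart: "?W (s + t) = l1_dist (semiflow (semiflow y s) t) (semiflow x t)"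
    if "0 \<le> s" "0 \<le> t" for s t
    unfolding l1_dist_def using that
    by (intro sum.cong) (auto simp: semiflow_semigroup y' semiflow_equilibrium[OF x])
  have "(?W \<longlongrightarrow> 0) at_top"
  proof (rule contraction_tendsto_0[where T = "real K", OF _ _ _ c(1,2)])
    show "0 \<le> ?W t" for t by (auto simp: l1_dist_def intro: sum_nonneg)
    show "?W (s + t) \<le> ?W s" if "0 \<le> s" "0 \<le> t" for s t
      using semiflow_nonexpansive[OF semiflow_mem[OF y' that(1)] x' that(2)] by (simp add: restart that)
    show "?W (s + real K) \<le> c * ?W s" if s: "0 \<le> s" for s
    proof -
      let ?v = "\<lambda>k. if k \<le> K then semiflow y s k else 0"
      note v = semiflow_standard_simplex[OF y s]
      then have v': "?v \<in> sub_simplex K" using standard_simplex_sub by auto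
      \<comment> \<open>The cut-off does not change the later trajectory: the two starting vectors
        lie below each other on \<open>{..K}\<close>, so monotonicity applies both ways.\<close>
      have "semiflow (semiflow y s) (real K) k = semiflow ?v (real K) k" if "k \<le> K" for k
        using semiflow_mono[OF semiflow_mem[OF y' s] v' _ _ that, of "real K"]
          semiflow_mono[OF v' semiflow_mem[OF y' s] _ _ that, of "real K"] by auto
      then have "?W (s + real K) = l1_dist (semiflow ?v K) (semiflow x K)"
        unfolding restart[OF s of_nat_0_le_iff] by (simp add: l1_dist_def)
      also have "\<dots> \<le> c * l1_dist ?v x" by (rule c(3)[OF v xs])
      also have "l1_dist ?v x = ?W s" by (simp add: l1_dist_def)
      finally show ?thesis .
    qed
  qed simp
  moreover have "norm (semiflow y t k - x k) \<le> ?W t" for t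
    unfolding l1_dist_def real_norm_def using k
    by (intro member_le_sum[of k "{..K}" "\<lambda>k. \<bar>semiflow y t k - x k\<bar>"]) auto
  ultimately have "((\<lambda>t. semiflow y t k - x k) \<longlongrightarrow> 0) at_top"
    by (intro Lim_null_comparison[OF _ \<open>(?W \<longlongrightarrow> 0) at_top\<close>] always_eventually) auto
  then show ?thesis by (simp add: LIM_zero_iff)
qed

lemma ode_solution_tendsto_equilibrium:
  assumes "equilibrium K q x" "ode_solution K q \<phi>" "\<phi> 0 \<in> standard_simplex K" "k \<le> K"
  shows "((\<lambda>t. \<phi> t k) \<longlongrightarrow> x k) at_top"
proof (rule Lim_transform_eventually)
  show "((\<lambda>t. semiflow (\<phi> 0) t k) \<longlongrightarrow> x k) at_top"
    by (rule semiflow_tendsto_equilibrium[OF assms(1,3,4)])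
  show "\<forall>\<^sub>F t in at_top. semiflow (\<phi> 0) t k = \<phi> t k"
    unfolding eventually_at_top_linorder
    by (intro exI[of _ 0] allI impI ode_solution_eq_semiflow[OF assms(2,3) _ assms(4), symmetric])
qed

text \<open>One equilibrium suffices: a second one would be stationary and yet converge to the
  first.\<close>

lemma globally_stableI:
  assumes x: "equilibrium K q x"
  shows "globally_stable K q"
proof -
  have unique: "y = x" if y: "equilibrium K q y" for y
  proof
    fix k
    have ys: "y \<in> standard_simplex K" using y by (simp add: equilibrium_def)
    show "y k = x k"
    proof (cases "k \<le> K")
      case True
      have "\<forall>\<^sub>F t in at_top. semiflow y t k = y k"
        unfolding eventually_at_top_linorder
        by (intro exI[of _ 0] allI impI semiflow_equilibrium[OF y _ True])
      from Lim_transform_eventually[OF semiflow_tendsto_equilibrium[OF x ys True] this]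
      have "((\<lambda>t::real. y k) \<longlongrightarrow> x k) at_top" .
      then show ?thesis by (simp add: tendsto_const_iff)
    next
      case False
      then show ?thesis using x y by (auto simp: equilibrium_def standard_simplex_def)
    qed
  qed
  have exists: "\<exists>\<phi>. ode_solution K q \<phi> \<and> \<phi> 0 = y" if y: "y \<in> standard_simplex K" for y
  proof (intro exI conjI)
    show "ode_solution K q (\<lambda>t k. if k \<le> K then semiflow y t k else 0)"
      by (rule ode_solution_semiflow[OF y])
    show "(\<lambda>k. if k \<le> K then semiflow y 0 k else 0) = y"
      using y standard_simplex_sub[of K]
      by (intro ext) (auto simp: semiflow_0 standard_simplex_def)
  qed
  have invariant: "\<phi> t \<in> standard_simplex K"
    if \<phi>: "ode_solution K q \<phi>" "\<phi> 0 \<in> standard_simplex K" and t: "0 \<le> t" for \<phi> t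
  proof -
    have "\<phi> t = (\<lambda>k. if k \<le> K then semiflow (\<phi> 0) t k else 0)"
      using ode_solution_eq_semiflow[OF \<phi> t] \<phi>(1) t
      by (intro ext) (auto simp: ode_solution_def)
    then show ?thesis using semiflow_standard_simplex[OF \<phi>(2) t] by simp
  qed
  show ?thesis unfolding globally_stable_def
  proof (intro conjI allI impI ballI ex1I[of _ x])
    fix z y \<phi> t k
    assume "equilibrium K q z" and y: "y \<in> standard_simplex K"
    then have z: "z = x" by (simp add: unique)
    show "\<exists>\<phi>. ode_solution K q \<phi> \<and> \<phi> 0 = y" by (rule exists[OF y])
    assume \<phi>: "ode_solution K q \<phi> \<and> \<phi> 0 = y"
    show "\<phi> t \<in> standard_simplex K" if "0 \<le> t" using invariant[of \<phi> t] \<phi> y that by simp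
    show "((\<lambda>t. \<phi> t k) \<longlongrightarrow> z k) at_top" if "k \<le> K"
      unfolding z using \<phi> y that by (intro ode_solution_tendsto_equilibrium[OF x]) auto
  qed (rule x, rule unique)
qed

end

section \<open>The geometric backoff rates and the optimal throughput\<close>

text \<open>At equilibrium the outflow \<open>q k * x k\<close> is \<open>g\<close> times that of
  stage \<open>k - 1\<close>, hence proportional to \<open>g ^ k\<close>; dividing by the rates
  gives weights \<open>g ^ k * m ^ k\<close>. Assumption \<open>a\<close> is the consistency
  condition that these weights reproduce the attempt rate \<open>a\<close>.\<close>

lemma geometric_equilibrium:
  fixes a g q0 m :: real
  assumes "0 \<le> g" "0 < m" "0 < q0" "g = 1 - exp (- a)"
    and a: "a / q0 = (\<Sum>k=0..K. g ^ k) / (\<Sum>k=0..K. g ^ k * m ^ k)"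
  defines "q \<equiv> \<lambda>k. q0 / m ^ k"
  obtains x where "equilibrium K q x" "attempt_rate K q x = a"
proof
  define S where "S = (\<Sum>k=0..K. g ^ k * m ^ k)"
  let ?x = "\<lambda>k. if k \<le> K then g ^ k * m ^ k / S else 0"
  have "(g * m) ^ 0 \<le> (\<Sum>k=0..K. (g * m) ^ k)"
    using assms by (intro member_le_sum) auto
  then have S: "1 \<le> S" by (simp add: S_def power_mult_distrib)
  have sum: "(\<Sum>k\<le>K. ?x k) = 1"
    using S by (simp add: S_def atMost_atLeast0 sum_divide_distrib[symmetric])
  have nonneg: "0 \<le> ?x k" for k using S assms by simp
  have "?x k \<le> 1" for k
  proof (cases "k \<le> K")
    case True
    then have "?x k \<le> (\<Sum>k\<le>K. ?x k)" by (intro member_le_sum nonneg) auto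
    then show ?thesis using sum by simp
  qed simp
  then have mem: "?x \<in> standard_simplex K"
    unfolding standard_simplex_def using nonneg sum by auto
  have qx: "q k * ?x k = q0 * g ^ k / S" if "k \<le> K" for k
    using \<open>0 < m\<close> that by (simp add: q_def)
  have "attempt_rate K q ?x = (\<Sum>k\<le>K. q0 * g ^ k / S)"
    unfolding attempt_rate_def by (intro sum.cong qx) auto
  also have "\<dots> = q0 * ((\<Sum>k=0..K. g ^ k) / S)"
    by (simp add: atMost_atLeast0 sum_divide_distrib[symmetric] sum_distrib_left[symmetric])
  also have "\<dots> = a" using a \<open>0 < q0\<close> by (simp add: S_def field_simps)
  finally show rate: "attempt_rate K q ?x = a" .
  have "drift K q ?x k = 0" if k: "k \<in> {1..K}" for k
  proof -
    have "drift K q ?x k = q (k - 1) * ?x (k - 1) * g - q k * ?x k"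
      unfolding drift_def collision_prob_def rate \<open>g = 1 - exp (- a)\<close>[symmetric] ..
    also have "\<dots> = q0 * g ^ (k - 1) / S * g - q0 * g ^ k / S"
      using k by (subst (1 2) qx) auto
    also have "\<dots> = 0" using k by (cases k) auto
    finally show ?thesis .
  qed
  then show "equilibrium K q ?x" using mem by (simp add: equilibrium_def)
qed

text \<open>The right-hand side has derivative \<open>x * exp x\<close> and rises from -1 at 0 to 0
  at 1, while the left-hand side lies above -1 and is at most 0.\<close>

lemma throughput_root:
  fixes Lc :: real
  assumes "1 \<le> Lc"
  shows "\<exists>!qs. 0 < qs \<and> 1 / Lc - 1 = (qs - 1) * exp qs"
    and "0 < qs \<Longrightarrow> 1 / Lc - 1 = (qs - 1) * exp qs \<Longrightarrow> qs \<le> 1"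
proof -
  let ?h = "\<lambda>x::real. (x - 1) * exp x"
  have mono: "?h x < ?h y" if "0 \<le> x" "x < y" for x y
  proof (rule DERIV_pos_imp_increasing_open[OF that(2)])
    fix z assume "x < z" "z < y"
    then have "(?h has_real_derivative z * exp z) (at z)" "0 < z * exp z"
      using that(1) by (auto intro!: derivative_eq_intros simp: algebra_simps)
    then show "\<exists>d. (?h has_real_derivative d) (at z) \<and> 0 < d" by blast
  qed (intro continuous_intros)
  have Lc: "-1 < 1 / Lc - 1" "1 / Lc - 1 \<le> 0" using assms by auto
  have "\<exists>x\<ge>0. x \<le> 1 \<and> ?h x = 1 / Lc - 1"
    using Lc by (intro IVT') (auto intro!: continuous_intros)
  then obtain x where x: "0 \<le> x" "?h x = 1 / Lc - 1" by blast
  then have "0 < x" using Lc by (cases "x = 0") auto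
  moreover have "x = y" if "0 < y" "1 / Lc - 1 = ?h y" for y
    using mono[of x y] mono[of y x] x that by (cases x y rule: linorder_cases) auto
  ultimately show "\<exists>!qs. 0 < qs \<and> 1 / Lc - 1 = ?h qs"
    using x by metis
  show "qs \<le> 1" if "0 < qs" "1 / Lc - 1 = ?h qs" for qs
  proof (rule ccontr)
    assume "\<not> qs \<le> 1"
    then have "0 < ?h qs" by simp
    then show False using that(2) Lc(2) by linarith
  qed
qed

text \<open>
  Dividing numerator and denominator of the throughput by \<open>P1 x\<close> leaves the minimisation of
  \<open>(1 + Lc * (exp x - 1)) / x\<close>, whose numerator lies above its tangent through the origin.
\<close>

lemma throughput_maximal:
  fixes L Lo Lc qs :: real
  assumes "L > 0" "Lo > 0" "Lc \<ge> 1" "0 < qs" and qs: "1 / Lc - 1 = (qs - 1) * exp qs"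
  shows "is_arg_max (throughput L Lo Lc) (\<lambda>x. x \<in> {0<..}) qs"
proof -
  define h where "h x = (1 + Lc * (exp x - 1)) / x" for x :: real
  \<comment> \<open>Keeps the denominator \<open>L + Lo - Lc + h x\<close> positive even when
    \<open>Lc\<close> exceeds \<open>L + Lo\<close>.\<close>
  have h_ge: "Lc + 1 / x \<le> h x" if "0 < x" for x
  proof -
    have "x \<le> exp x - 1" using exp_ge_add_one_self[of x] by linarith
    then have "Lc * x \<le> Lc * (exp x - 1)"
      using \<open>Lc \<ge> 1\<close> by (intro mult_left_mono) auto
    then have "Lc \<le> Lc * (exp x - 1) / x" using that by (simp add: pos_le_divide_eq)
    then show ?thesis by (simp add: h_def add_divide_distrib)
  qed
  have thr: "throughput L Lo Lc x = L / (L + Lo - Lc + h x)" if "0 < x" for x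
  proof -
    have "P1 x * (L + Lo) + P0 x + Pc x * Lc = P1 x * (L + Lo - Lc + h x)"
      using that by (simp add: P1_def P0_def Pc_def h_def field_simps exp_minus)
    then show ?thesis using that by (simp add: throughput_def P1_def)
  qed
  \<comment> \<open>The equation for \<open>qs\<close> says that the tangent to
    \<open>1 + Lc * (exp x - 1)\<close> at \<open>qs\<close> passes through the origin; its slope is
    \<open>Lc * exp qs\<close>.\<close>
  have root: "Lc * ((1 - qs) * exp qs) = Lc - 1"
    using qs \<open>Lc \<ge> 1\<close> by (simp add: field_simps)
  have hqs: "h qs = Lc * exp qs"
    using root \<open>0 < qs\<close> by (simp add: h_def field_simps)
  have h_min: "h qs \<le> h x" if "0 < x" for x
  proof -
    have "exp qs * (1 + (x - qs)) \<le> exp qs * exp (x - qs)"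
      by (intro mult_left_mono) auto
    then have "Lc * (exp qs * (1 + (x - qs))) \<le> Lc * exp x"
      using \<open>Lc \<ge> 1\<close> by (simp add: exp_add[symmetric])
    then have "Lc * exp qs * x \<le> 1 + Lc * (exp x - 1)"
      using root by (simp add: algebra_simps)
    then show ?thesis using that by (simp only: hqs) (simp add: h_def pos_le_divide_eq)
  qed
  have "throughput L Lo Lc x \<le> throughput L Lo Lc qs" if "0 < x" for x
  proof -
    have "0 < 1 / qs" using \<open>0 < qs\<close> by simp
    then have "0 < L + Lo - Lc + h qs" using h_ge[OF \<open>0 < qs\<close>] assms by linarith
    then show ?thesis
      using h_min[OF that] \<open>L > 0\<close> unfolding thr[OF that] thr[OF \<open>0 < qs\<close>]
      by (intro divide_left_mono mult_pos_pos) auto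
  qed
  then show ?thesis using \<open>0 < qs\<close> by (fastforce simp: is_arg_max_def)
qed

text \<open>The denominator increases with \<open>m\<close> and equals the numerator at
  \<open>m = 1\<close>, so a ratio of at most 1 calls for \<open>m\<close> at least 1.\<close>

lemma geometric_ratio:
  fixes g r :: real
  assumes "1 \<le> K" "0 < g" "0 < r" "r \<le> 1"
  shows "\<exists>m>0. r = (\<Sum>k=0..K. g ^ k) / (\<Sum>k=0..K. g ^ k * m ^ k)"
    and "0 < m \<Longrightarrow> r = (\<Sum>k=0..K. g ^ k) / (\<Sum>k=0..K. g ^ k * m ^ k) \<Longrightarrow> 1 \<le> m"
proof -
  let ?f = "\<lambda>m. \<Sum>k=0..K. g ^ k * m ^ k"
  have f1: "(\<Sum>k=0..K. g ^ k) = ?f 1" by simp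
  have pos: "0 < ?f m" if "0 < m" for m using that assms by (intro sum_pos) auto
  \<comment> \<open>Chosen so that the term \<open>g * M\<close> of index 1 alone reaches the target
    \<open>?f 1 / r\<close>; this term is present because \<open>K\<close> is at least 1.\<close>
  define M where "M = max 1 (?f 1 / r / g)"
  have "?f 1 / r \<le> g * M" using assms by (simp add: M_def max_def field_simps)
  also have "g * M = g ^ 1 * M ^ 1" by simp
  also have "\<dots> \<le> ?f M"
    using assms by (intro member_le_sum[where f = "\<lambda>k. g ^ k * M ^ k"]) (auto simp: M_def)
  finally have "?f 1 / r \<le> ?f M" .
  moreover have "?f 1 \<le> ?f 1 / r" using assms pos[of 1] by (simp add: field_simps)
  ultimately have "\<exists>m\<ge>1. m \<le> M \<and> ?f m = ?f 1 / r"
    by (intro IVT') (auto intro!: continuous_intros simp: M_def)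
  then obtain m where m: "1 \<le> m" "?f m = ?f 1 / r" by blast
  have "r = ?f 1 / ?f m" unfolding m(2) using assms pos[of 1] by simp
  then show "\<exists>m>0. r = (\<Sum>k=0..K. g ^ k) / ?f m" unfolding f1 using m(1) by (intro exI[of _ m]) auto
  show "1 \<le> m" if "0 < m" "r = (\<Sum>k=0..K. g ^ k) / ?f m" for m
  proof (rule ccontr)
    assume "\<not> 1 \<le> m"
    have "?f m < ?f 1"
      using assms \<open>0 < m\<close> \<open>\<not> 1 \<le> m\<close>
      \<comment> \<open>The term of index 1 makes the inequality strict.\<close>
      by (intro sum_strict_mono_ex1) (auto intro!: power_le_one bexI[of _ 1])
    then have "1 < ?f 1 / ?f m" using pos[OF that(1)] by simp
    then show False using that(2) assms(4) unfolding f1 by simp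
  qed
qed

theorem mainTheorem3:
  fixes K :: nat and L Lo Lc :: real
  assumes "K \<ge> 1" and "L > 0" and "Lo > 0" and "Lc \<ge> 1"
  shows "(\<exists>!qs. qs > 0 \<and> 1 / Lc - 1 = (qs - 1) * exp qs) \<and>
    (\<forall>qs. qs > 0 \<and> 1 / Lc - 1 = (qs - 1) * exp qs \<longrightarrow>
      qs \<le> 1 \<and>
      (\<forall>q0\<in>{qs..1}.
        (\<exists>m>0. qs / q0 = (\<Sum>k=0..K. (1 - exp (- qs)) ^ k) / (\<Sum>k=0..K. (1 - exp (- qs)) ^ k * m ^ k)) \<and>
        (\<forall>m>0. qs / q0 = (\<Sum>k=0..K. (1 - exp (- qs)) ^ k) / (\<Sum>k=0..K. (1 - exp (- qs)) ^ k * m ^ k) \<longrightarrow>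
          globally_stable K (\<lambda>k. q0 / m ^ k) \<and>
          (\<exists>qlim.
            (\<forall>\<phi>. ode_solution K (\<lambda>k. q0 / m ^ k) \<phi> \<and> \<phi> 0 \<in> standard_simplex K \<longrightarrow>
              ((\<lambda>t. attempt_rate K (\<lambda>k. q0 / m ^ k) (\<phi> t)) \<longlongrightarrow> qlim) at_top) \<and>
            is_arg_max (throughput L Lo Lc) (\<lambda>x. x \<in> {0<..}) qlim))))"
proof (intro conjI throughput_root(1)[OF \<open>Lc \<ge> 1\<close>] allI impI; (elim conjE)?)
  fix qs assume qs: "qs > 0" "1 / Lc - 1 = (qs - 1) * exp qs"
  show "qs \<le> 1" by (rule throughput_root(2)[OF \<open>Lc \<ge> 1\<close> qs])
next
  fix qs assume qs: "qs > 0" "1 / Lc - 1 = (qs - 1) * exp qs"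
  let ?g = "1 - exp (- qs)"
  let ?ratio = "\<lambda>m. (\<Sum>k=0..K. ?g ^ k) / (\<Sum>k=0..K. ?g ^ k * m ^ k)"
  show "\<forall>q0\<in>{qs..1}. (\<exists>m>0. qs / q0 = ?ratio m) \<and>
      (\<forall>m>0. qs / q0 = ?ratio m \<longrightarrow> globally_stable K (\<lambda>k. q0 / m ^ k) \<and>
        (\<exists>qlim. (\<forall>\<phi>. ode_solution K (\<lambda>k. q0 / m ^ k) \<phi> \<and> \<phi> 0 \<in> standard_simplex K \<longrightarrow>
            ((\<lambda>t. attempt_rate K (\<lambda>k. q0 / m ^ k) (\<phi> t)) \<longlongrightarrow> qlim) at_top) \<and>
          is_arg_max (throughput L Lo Lc) (\<lambda>x. x \<in> {0<..}) qlim))"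
  proof (intro ballI conjI[OF _ allI[OF impI[OF impI]]])
    fix q0 assume q0: "q0 \<in> {qs..1}"
    have g: "0 < ?g" using qs by simp
    have r: "0 < qs / q0" "qs / q0 \<le> 1" and q0_pos: "0 < q0" using qs q0 by auto
    show "\<exists>m>0. qs / q0 = ?ratio m"
      by (rule geometric_ratio(1)[OF \<open>K \<ge> 1\<close> g r])
    fix m :: real assume m: "m > 0" and ratio: "qs / q0 = ?ratio m"
    let ?q = "\<lambda>k. q0 / m ^ k"
    \<comment> \<open>This holds for every solution \<open>m\<close> of the ratio equation and
      bounds all rates by \<open>q0\<close>, hence by 1, as the locale requires.\<close>
    have m1: "1 \<le> m" by (rule geometric_ratio(2)[OF \<open>K \<ge> 1\<close> g r m ratio])
    have "?q k \<le> 1" for k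
    proof -
      have "q0 \<le> 1 * m ^ k" using q0 one_le_power[OF m1, of k] by simp
      then show ?thesis using m by (simp add: pos_divide_le_eq)
    qed
    then interpret backoff K ?q
      using q0_pos m by unfold_locales auto
    obtain x where x: "equilibrium K ?q x" "attempt_rate K ?q x = qs"
      using geometric_equilibrium[OF less_imp_le[OF g] m q0_pos refl ratio] by blast
    \<comment> \<open>The attempt rate is a finite linear combination of the coordinates, so it
      converges to its value \<open>qs\<close> at the equilibrium, which is the maximiser of the
      throughput.\<close>
    have rate: "((\<lambda>t. attempt_rate K ?q (\<phi> t)) \<longlongrightarrow> qs) at_top"
      if "ode_solution K ?q \<phi> \<and> \<phi> 0 \<in> standard_simplex K" for \<phi>
    proof -
      have "((\<lambda>t. attempt_rate K ?q (\<phi> t)) \<longlongrightarrow> attempt_rate K ?q x) at_top"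
        unfolding attempt_rate_def using that
        by (intro tendsto_intros ode_solution_tendsto_equilibrium[OF x(1)]) auto
      then show ?thesis by (simp only: x(2))
    qed
    show "globally_stable K ?q \<and>
        (\<exists>qlim. (\<forall>\<phi>. ode_solution K ?q \<phi> \<and> \<phi> 0 \<in> standard_simplex K \<longrightarrow>
            ((\<lambda>t. attempt_rate K ?q (\<phi> t)) \<longlongrightarrow> qlim) at_top) \<and>
          is_arg_max (throughput L Lo Lc) (\<lambda>x. x \<in> {0<..}) qlim)"
      using globally_stableI[OF x(1)] rate throughput_maximal[OF \<open>L > 0\<close> \<open>Lo > 0\<close> \<open>Lc \<ge> 1\<close> qs]
      by (intro conjI exI[of _ qs] allI impI)
  qed
qed

end
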